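(* Let $(\Omega,\mathcal F,\mathbb P)$ be a standard probability space, $\theta:\Omega\to\Omega$ an invertible, bimeasurable, measure-preserving transformation, $(X,d)$ Polish, $Y$ a Banach space, $1\le p<\infty$, and let $G_\omega:X\times X\to Y$ ($\omega\in\Omega$) be a measurable family inducing the one-step residual $(G\Gamma)(\omega)=G_\omega(\Gamma(\omega),\Gamma(\theta\omega))$ on measurable sections $\Gamma:\Omega\to X$. Let $\xi_0,\xi_1\in L^p(\Omega;X)$ satisfy $$G_\omega(\xi_i(\omega),\xi_i(\theta\omega))=0\ \text{ a.e. } (i=0,1),\qquad d(\xi_0(\omega),\xi_1(\omega))>0\ \text{ a.e.}$$ Put $$q(\omega)=\max_{i\ne j}\|G_\omega(\xi_i(\omega),\xi_j(\theta\omega))\|_Y,\qquad r(\omega)=\min_{i\ne j}\|G_\omega(\xi_i(\omega),\xi_j(\theta\omega))\|_Y,$$ where $i,j\in\{0,1\}$, and assume $q\in L^p(\Omega)$ and $r>0$ a.e. For measurable $A\subset\Omega$ let $\Gamma_A=\xi_1$ on $A$ and $\Gamma_A=\xi_0$ on $A^c$. Then for every sequence of measurable sets $A_n\subset\Omega$, $$\|G(\Gamma_{A_n})\|_{L^p}\to0\quad\Longleftrightarrow\quad\mathbb P(A_n\triangle\theta^{-1}A_n)\to0 .$$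
   Context: $L^p(\Omega;X)$ is the set of a.e.-classes of strongly measurable $u:\Omega\to X$ with $\int_\Omega d(u(\omega),x_\circ)^p\,d\mathbb P<\infty$ for a fixed $x_\circ\in X$. A measurable family $G_\omega$ means that $(\omega,x,y)\mapsto G_\omega(x,y)$ is measurable. $\|G(\Gamma)\|_{L^p}^p=\int_\Omega\|G_\omega(\Gamma(\omega),\Gamma(\theta\omega))\|_Y^p\,d\mathbb P(\omega)$. *)

theory Defs
  imports "HOL-Probability.Probability"
begin

text \<open>
  Isomorphism modulo null sets. Passing to completions makes the notion insensitive to whether the
  measure spaces themselves are complete.
\<close>

definition isomorphic_mod_0 :: "'a measure \<Rightarrow> 'b measure \<Rightarrow> bool" where
  "isomorphic_mod_0 M N \<longleftrightarrow>
    (\<exists>A \<in> null_sets (completion M). \<exists>B \<in> null_sets (completion N). \<exists>f.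
      let M' = restrict_space (completion M) (space M - A);
          N' = restrict_space (completion N) (space N - B)
      in bij_betw f (space M') (space N') \<and>
         f \<in> measurable M' N' \<and>
         inv_into (space M') f \<in> measurable N' M' \<and>
         distr M' N' f = N')"

text \<open>
  Every standard Borel space is Borel isomorphic to a Borel subset of the real line, so it suffices
  to allow Borel probability measures on the real line as models. The definition covers both common
  conventions: standard Borel spaces with a Borel probability measure, and (complete)
  Lebesgue-Rokhlin spaces.
\<close>

definition standard_prob_space :: "'a measure \<Rightarrow> bool" where
  "standard_prob_space M \<longleftrightarrow>
    prob_space M \<and>
    (\<exists>N :: real measure. prob_space N \<and> sets N = sets borel \<and> isomorphic_mod_0 M N)"

definition mp_automorphism :: "'a measure \<Rightarrow> ('a \<Rightarrow> 'a) \<Rightarrow> bool" where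
  "mp_automorphism M \<theta> \<longleftrightarrow>
    bij_betw \<theta> (space M) (space M) \<and>
    \<theta> \<in> measurable M M \<and>
    inv_into (space M) \<theta> \<in> measurable M M \<and>
    distr M M \<theta> = M"

text \<open>
  The simple functions converge everywhere on the space, not merely almost everywhere, so that
  strongly measurable functions are Borel measurable even if \<open>M\<close> is not complete.
\<close>

definition strongly_measurable :: "'a measure \<Rightarrow> ('a \<Rightarrow> 'b::metric_space) \<Rightarrow> bool" where
  "strongly_measurable M u \<longleftrightarrow>
    (\<exists>s :: nat \<Rightarrow> 'a \<Rightarrow> 'b. (\<forall>n. simple_function M (s n)) \<and>
      (\<forall>\<omega> \<in> space M. (\<lambda>n. s n \<omega>) \<longlonglongrightarrow> u \<omega>))"

text \<open>
  Representatives of the elements of \<open>L\<^sup>p(M; X)\<close>; the functions are not quotiented by equality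
  almost everywhere. For scalar functions the base point is \<open>0\<close>.
\<close>

definition Lp_maps :: "'a measure \<Rightarrow> real \<Rightarrow> 'b::metric_space \<Rightarrow> ('a \<Rightarrow> 'b) set" where
  "Lp_maps M p x0 =
    {u. strongly_measurable M u \<and> (\<integral>\<^sup>+\<omega>. ennreal (dist (u \<omega>) x0 powr p) \<partial>M) < \<infinity>}"

definition Lp_norm :: "'a measure \<Rightarrow> real \<Rightarrow> ('a \<Rightarrow> 'b::real_normed_vector) \<Rightarrow> ennreal" where
  "Lp_norm M p f =
    (let I = (\<integral>\<^sup>+\<omega>. ennreal (norm (f \<omega>) powr p) \<partial>M)
     in if I = \<infinity> then \<infinity> else ennreal (enn2real I powr (1 / p)))"

definition residual ::
    "('a \<Rightarrow> 'x \<Rightarrow> 'x \<Rightarrow> 'y) \<Rightarrow> ('a \<Rightarrow> 'a) \<Rightarrow> ('a \<Rightarrow> 'x) \<Rightarrow> 'a \<Rightarrow> 'y" where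
  "residual G \<theta> \<Gamma> = (\<lambda>\<omega>. G \<omega> (\<Gamma> \<omega>) (\<Gamma> (\<theta> \<omega>)))"

definition switch_max ::
    "('a \<Rightarrow> 'x \<Rightarrow> 'x \<Rightarrow> 'y::real_normed_vector) \<Rightarrow> ('a \<Rightarrow> 'a) \<Rightarrow> ('a \<Rightarrow> 'x) \<Rightarrow> ('a \<Rightarrow> 'x) \<Rightarrow> 'a \<Rightarrow> real"
  where
  "switch_max G \<theta> \<xi>0 \<xi>1 = (\<lambda>\<omega>.
    max (norm (G \<omega> (\<xi>0 \<omega>) (\<xi>1 (\<theta> \<omega>)))) (norm (G \<omega> (\<xi>1 \<omega>) (\<xi>0 (\<theta> \<omega>)))))"

definition switch_min ::
    "('a \<Rightarrow> 'x \<Rightarrow> 'x \<Rightarrow> 'y::real_normed_vector) \<Rightarrow> ('a \<Rightarrow> 'a) \<Rightarrow> ('a \<Rightarrow> 'x) \<Rightarrow> ('a \<Rightarrow> 'x) \<Rightarrow> 'a \<Rightarrow> real"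
  where
  "switch_min G \<theta> \<xi>0 \<xi>1 = (\<lambda>\<omega>.
    min (norm (G \<omega> (\<xi>0 \<omega>) (\<xi>1 (\<theta> \<omega>)))) (norm (G \<omega> (\<xi>1 \<omega>) (\<xi>0 (\<theta> \<omega>)))))"

definition switch_section :: "('a \<Rightarrow> 'x) \<Rightarrow> ('a \<Rightarrow> 'x) \<Rightarrow> 'a set \<Rightarrow> 'a \<Rightarrow> 'x" where
  "switch_section \<xi>0 \<xi>1 A = (\<lambda>\<omega>. if \<omega> \<in> A then \<xi>1 \<omega> else \<xi>0 \<omega>)"

end

theory Submission
  imports Defs
begin

text \<open>
  The residual of a switched section vanishes almost everywhere off the switching set
  \<open>E\<^sub>n = A\<^sub>n \<triangle> \<theta>\<^sup>-\<^sup>1 A\<^sub>n\<close>: if \<open>\<omega>\<close> and \<open>\<theta> \<omega>\<close> lie on the same side of \<open>A\<^sub>n\<close>, both arguments of \<open>G \<omega>\<close> come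
  from the same exact solution. On \<open>E\<^sub>n\<close> the two arguments come from different solutions, so the
  norm of the residual there lies between \<open>r\<close> and \<open>q\<close>. With \<open>I\<^sub>n\<close> the \<open>p\<close>-th power of the
  \<open>L\<^sup>p\<close> norm this gives
  \<open>\<integral>\<^sub>E\<^sub>n r\<^sup>p dM \<le> I\<^sub>n \<le> \<integral>\<^sub>E\<^sub>n q\<^sup>p dM\<close>.

  Both directions then are the same statement about measures: if \<open>\<mu>\<close> is finite and absolutely
  continuous with respect to \<open>\<nu>\<close>, then \<open>\<nu> E\<^sub>n \<rightarrow> 0\<close> forces \<open>\<mu> E\<^sub>n \<rightarrow> 0\<close>
  (\<open>emeasure_tendsto_0_absolutely_continuous\<close>). A small residual makes the measure \<open>r\<^sup>p dM\<close> of \<open>E\<^sub>n\<close>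
  small, and \<open>M\<close> is absolutely continuous with respect to \<open>r\<^sup>p dM\<close> because \<open>r > 0\<close> almost everywhere.
  Conversely, \<open>q\<^sup>p dM\<close> is absolutely continuous with respect to \<open>M\<close>, and it is finite because
  \<open>q \<in> L\<^sup>p\<close>.
\<close>

text \<open>
  If the conclusion failed, some selection of the sets would have \<open>\<mu>\<close>-measure at least some
  \<open>\<epsilon> > 0\<close> but summable \<open>\<nu>\<close>-measure. By Borel--Cantelli its limit superior is \<open>\<nu>\<close>-null, hence
  \<open>\<mu>\<close>-null; but as \<open>\<mu>\<close> is finite, continuity from above gives that limit superior \<open>\<mu>\<close>-measure at
  least \<open>\<epsilon>\<close>.
\<close>

lemma emeasure_tendsto_0_absolutely_continuous:
  assumes "finite_measure \<mu>" and ac: "absolutely_continuous \<nu> \<mu>" and sets_eq: "sets \<mu> = sets \<nu>"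
    and E: "\<And>n. E n \<in> sets \<nu>"
    and lim: "(\<lambda>n. emeasure \<nu> (E n)) \<longlonglongrightarrow> 0"
  shows "(\<lambda>n::nat. emeasure \<mu> (E n)) \<longlonglongrightarrow> 0"
proof -
  interpret finite_measure \<mu> by fact
  have "(\<lambda>n. measure \<mu> (E n)) \<longlonglongrightarrow> 0"
  proof (rule ccontr)
    assume "\<not> ?thesis"
    then obtain \<epsilon> where "\<epsilon> > 0" and "\<And>N. \<exists>n\<ge>N. \<epsilon> \<le> measure \<mu> (E n)"
      by (force simp: lim_sequentially not_less)
    moreover have "\<exists>N. \<forall>n\<ge>N. emeasure \<nu> (E n) < ennreal ((1/2)^k)" for k
      using order_tendstoD(2)[OF lim, of "ennreal ((1/2)^k)"] by (simp add: eventually_sequentially)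
    ultimately have "\<exists>n. \<epsilon> \<le> measure \<mu> (E n) \<and> emeasure \<nu> (E n) < ennreal ((1/2)^k)" for k
      by meson
    then obtain s where s: "\<And>k. \<epsilon> \<le> measure \<mu> (E (s k))"
        "\<And>k. emeasure \<nu> (E (s k)) < ennreal ((1/2)^k)"
      by metis
    define B where "B k = E (s k)" for k
    have B\<nu>: "B k \<in> sets \<nu>" and B[measurable]: "B k \<in> sets \<mu>" for k
      using E sets_eq by (auto simp: B_def)
    have "measure \<nu> (B k) \<le> (1/2)^k" for k
      using s(2)[of k] by (simp add: B_def measure_def enn2real_leI)
    then have "summable (\<lambda>k. measure \<nu> (B k))"
      by (intro summable_comparison_test'[OF summable_geometric[of "1/2::real"]]) auto
    moreover have "emeasure \<nu> (B k) < \<infinity>" for k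
      using s(2)[of k] by (auto simp: B_def intro: less_trans)
    ultimately have "limsup B \<in> null_sets \<mu>"
      using borel_cantelli_limsup1[OF B\<nu>] ac by (auto simp: absolutely_continuous_def)
    then have "measure \<mu> (\<Inter>k. \<Union>n\<in>{k..}. B n) = 0"
      by (simp add: limsup_INF_SUP null_sets_def measure_def)
    moreover have "(\<lambda>k. measure \<mu> (\<Union>n\<in>{k..}. B n)) \<longlonglongrightarrow> measure \<mu> (\<Inter>k. \<Union>n\<in>{k..}. B n)"
      by (rule finite_Lim_measure_decseq) (auto simp: decseq_def, force)
    moreover have "\<epsilon> \<le> measure \<mu> (\<Union>n\<in>{k..}. B n)" for k
      using s(1)[of k] by (rule order_trans) (auto simp: B_def[symmetric] intro!: finite_measure_mono)
    ultimately have "\<epsilon> \<le> 0"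
      by (metis LIMSEQ_le_const)
    with \<open>\<epsilon> > 0\<close> show False by simp
  qed
  then show ?thesis
    by (simp add: emeasure_eq_measure flip: ennreal_0)
qed

lemma strongly_measurable_imp_borel_measurable:
  fixes u :: "'a \<Rightarrow> 'b::metric_space"
  assumes "strongly_measurable M u"
  shows "u \<in> borel_measurable M"
proof -
  obtain s :: "nat \<Rightarrow> 'a \<Rightarrow> 'b"
    where s: "\<And>n. simple_function M (s n)" "\<And>\<omega>. \<omega> \<in> space M \<Longrightarrow> (\<lambda>n. s n \<omega>) \<longlonglongrightarrow> u \<omega>"
    using assms unfolding strongly_measurable_def by blast
  show ?thesis
    by (rule borel_measurable_LIMSEQ_metric[OF borel_measurable_simple_function, OF s])
qed

lemma Lp_norm_tendsto_0_iff:
  fixes f :: "nat \<Rightarrow> 'a \<Rightarrow> 'b::real_normed_vector"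
  assumes "p > 0" and fin: "\<And>n. (\<integral>\<^sup>+\<omega>. ennreal (norm (f n \<omega>) powr p) \<partial>M) < \<infinity>"
  shows "(\<lambda>n. Lp_norm M p (f n)) \<longlonglongrightarrow> 0 \<longleftrightarrow>
    (\<lambda>n. \<integral>\<^sup>+\<omega>. ennreal (norm (f n \<omega>) powr p) \<partial>M) \<longlonglongrightarrow> 0"
proof -
  define x where "x n = enn2real (\<integral>\<^sup>+\<omega>. ennreal (norm (f n \<omega>) powr p) \<partial>M)" for n
  have x: "(\<integral>\<^sup>+\<omega>. ennreal (norm (f n \<omega>) powr p) \<partial>M) = ennreal (x n)" for n
    using fin[of n] by (simp add: x_def)
  have "Lp_norm M p (f n) = ennreal (x n powr (1/p))" for n
    using fin[of n] by (auto simp: Lp_norm_def x_def Let_def)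
  moreover have x_nonneg: "0 \<le> x n" for n by (simp add: x_def)
  moreover have "(\<lambda>n. x n powr (1/p)) \<longlonglongrightarrow> 0 \<longleftrightarrow> x \<longlonglongrightarrow> 0"
  proof
    assume "(\<lambda>n. x n powr (1/p)) \<longlonglongrightarrow> 0"
    from tendsto_zero_powrI[OF this tendsto_const, of p] show "x \<longlonglongrightarrow> 0"
      using \<open>p > 0\<close> by (simp add: powr_powr x_nonneg)
  next
    assume "x \<longlonglongrightarrow> 0"
    from tendsto_zero_powrI[OF this tendsto_const, of "1/p"] show "(\<lambda>n. x n powr (1/p)) \<longlonglongrightarrow> 0"
      using \<open>p > 0\<close> by (simp add: x_nonneg)
  qed
  ultimately show ?thesis
    by (simp add: x flip: ennreal_0)
qed

text \<open>
  Only the four combinations of \<open>\<omega> \<in> A\<close> and \<open>\<theta> \<omega> \<in> A\<close> matter. The bounds are pointwise because the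
  null sets on which the two solution equations fail come from \<open>\<xi>0\<close> and \<open>\<xi>1\<close> alone, whatever \<open>A\<close> is.
\<close>

lemma norm_residual_switch_section_bounds:
  fixes A :: "'a set" and M :: "'a measure"
    and G :: "'a \<Rightarrow> 'x \<Rightarrow> 'x \<Rightarrow> 'y::real_normed_vector"
  assumes "G \<omega> (\<xi>0 \<omega>) (\<xi>0 (\<theta> \<omega>)) = 0" and "G \<omega> (\<xi>1 \<omega>) (\<xi>1 (\<theta> \<omega>)) = 0" and "\<omega> \<in> space M"
  defines "E \<equiv> sym_diff A (\<theta> -` A \<inter> space M)"
  shows "switch_min G \<theta> \<xi>0 \<xi>1 \<omega> * indicator E \<omega> \<le> norm (residual G \<theta> (switch_section \<xi>0 \<xi>1 A) \<omega>)"
    and "norm (residual G \<theta> (switch_section \<xi>0 \<xi>1 A) \<omega>) \<le> switch_max G \<theta> \<xi>0 \<xi>1 \<omega> * indicator E \<omega>"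
proof -
  have E_iff: "\<omega> \<in> E \<longleftrightarrow> (\<omega> \<in> A) \<noteq> (\<theta> \<omega> \<in> A)"
    using assms(3) by (auto simp: E_def)
  note defs = residual_def switch_section_def switch_min_def switch_max_def indicator_def E_iff
  show "switch_min G \<theta> \<xi>0 \<xi>1 \<omega> * indicator E \<omega> \<le> norm (residual G \<theta> (switch_section \<xi>0 \<xi>1 A) \<omega>)"
    by (cases "\<omega> \<in> A"; cases "\<theta> \<omega> \<in> A") (simp_all add: defs assms(1,2))
  show "norm (residual G \<theta> (switch_section \<xi>0 \<xi>1 A) \<omega>) \<le> switch_max G \<theta> \<xi>0 \<xi>1 \<omega> * indicator E \<omega>"
    by (cases "\<omega> \<in> A"; cases "\<theta> \<omega> \<in> A") (simp_all add: defs assms(1,2))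
qed

theorem theorem8p2:
  fixes M :: "'a measure"
    and \<theta> :: "'a \<Rightarrow> 'a"
    and G :: "'a \<Rightarrow> 'x::polish_space \<Rightarrow> 'x \<Rightarrow> 'y::banach"
    and p :: real
    and x0 :: 'x
    and \<xi>0 \<xi>1 :: "'a \<Rightarrow> 'x"
    and A :: "nat \<Rightarrow> 'a set"
  assumes "standard_prob_space M"
    and "mp_automorphism M \<theta>"
    and "1 \<le> p"
    and "(\<lambda>(\<omega>, x, y). G \<omega> x y) \<in> borel_measurable (M \<Otimes>\<^sub>M borel \<Otimes>\<^sub>M borel)"
    and "\<xi>0 \<in> Lp_maps M p x0"
    and "\<xi>1 \<in> Lp_maps M p x0"
    and "AE \<omega> in M. G \<omega> (\<xi>0 \<omega>) (\<xi>0 (\<theta> \<omega>)) = 0"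
    and "AE \<omega> in M. G \<omega> (\<xi>1 \<omega>) (\<xi>1 (\<theta> \<omega>)) = 0"
    and "AE \<omega> in M. dist (\<xi>0 \<omega>) (\<xi>1 \<omega>) > 0"
    and "switch_max G \<theta> \<xi>0 \<xi>1 \<in> Lp_maps M p 0"
    and "AE \<omega> in M. switch_min G \<theta> \<xi>0 \<xi>1 \<omega> > 0"
    and "\<And>n. A n \<in> sets M"
  shows "(\<lambda>n. Lp_norm M p (residual G \<theta> (switch_section \<xi>0 \<xi>1 (A n)))) \<longlonglongrightarrow> 0
    \<longleftrightarrow> (\<lambda>n. measure M (sym_diff (A n) (\<theta> -` A n \<inter> space M))) \<longlonglongrightarrow> 0"
proof -
  interpret prob_space M
    using assms(1) by (simp add: standard_prob_space_def)
  have \<theta>[measurable]: "\<theta> \<in> measurable M M"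
    using assms(2) by (simp add: mp_automorphism_def)
  have [measurable]: "\<xi>0 \<in> borel_measurable M" "\<xi>1 \<in> borel_measurable M"
    using assms(5,6) by (auto simp: Lp_maps_def intro: strongly_measurable_imp_borel_measurable)
  have G: "(\<lambda>\<omega>. G \<omega> (f \<omega>) (g (\<theta> \<omega>))) \<in> borel_measurable M"
    if [measurable]: "f \<in> borel_measurable M" "g \<in> borel_measurable M" for f g
    using measurable_compose[OF _ assms(4), of "\<lambda>\<omega>. (\<omega>, f \<omega>, g (\<theta> \<omega>))" M] by simp
  note [measurable] = G[of \<xi>0 \<xi>1] G[of \<xi>1 \<xi>0]
  let ?r = "switch_min G \<theta> \<xi>0 \<xi>1" and ?q = "switch_max G \<theta> \<xi>0 \<xi>1"
  define E where "E n = sym_diff (A n) (\<theta> -` A n \<inter> space M)" for n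
  define h where "h n = residual G \<theta> (switch_section \<xi>0 \<xi>1 (A n))" for n
  define I where "I n = (\<integral>\<^sup>+\<omega>. ennreal (norm (h n \<omega>) powr p) \<partial>M)" for n
  \<comment> \<open>The measures \<open>r\<^sup>p dM\<close> and \<open>q\<^sup>p dM\<close>, whose values on \<open>E n\<close> enclose the integral \<open>I n\<close>.\<close>
  define R where "R = density M (\<lambda>\<omega>. ennreal (?r \<omega> powr p))"
  define Q where "Q = density M (\<lambda>\<omega>. ennreal (?q \<omega> powr p))"
  have [measurable]: "?r \<in> borel_measurable M" "?q \<in> borel_measurable M"
    unfolding switch_min_def switch_max_def by measurable
  have E[measurable]: "E n \<in> sets M" for n
    unfolding E_def using assms(12)[of n] measurable_sets[OF \<theta> assms(12)[of n]] by auto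
  have r0: "0 \<le> ?r \<omega>" and q0: "0 \<le> ?q \<omega>" for \<omega>
    by (simp_all add: switch_min_def switch_max_def le_max_iff_disj)
  have "AE \<omega> in M. ?r \<omega> * indicator (E n) \<omega> \<le> norm (h n \<omega>) \<and> norm (h n \<omega>) \<le> ?q \<omega> * indicator (E n) \<omega>"
    for n
    using assms(7,8) AE_space[of M]
  proof eventually_elim
    case (elim \<omega>)
    then show ?case
      unfolding h_def E_def by (intro conjI norm_residual_switch_section_bounds)
  qed
  then have "AE \<omega> in M.
      ennreal (?r \<omega> powr p) * indicator (E n) \<omega> \<le> ennreal (norm (h n \<omega>) powr p) \<and>
      ennreal (norm (h n \<omega>) powr p) \<le> ennreal (?q \<omega> powr p) * indicator (E n) \<omega>" for n
  proof (rule eventually_mono)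
    fix \<omega>
    assume "?r \<omega> * indicator (E n) \<omega> \<le> norm (h n \<omega>) \<and> norm (h n \<omega>) \<le> ?q \<omega> * indicator (E n) \<omega>"
    then show "ennreal (?r \<omega> powr p) * indicator (E n) \<omega> \<le> ennreal (norm (h n \<omega>) powr p) \<and>
        ennreal (norm (h n \<omega>) powr p) \<le> ennreal (?q \<omega> powr p) * indicator (E n) \<omega>"
      using \<open>1 \<le> p\<close> r0[of \<omega>] q0[of \<omega>]
      by (cases "\<omega> \<in> E n") (simp_all add: ennreal_leI powr_mono2)
  qed
  then have RI: "emeasure R (E n) \<le> I n" and IQ: "I n \<le> emeasure Q (E n)" for n
    by (simp_all add: R_def Q_def I_def emeasure_density nn_integral_mono_AE)
  have "(\<integral>\<^sup>+\<omega>. ennreal (?q \<omega> powr p) \<partial>M) < \<infinity>"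
    using assms(10) q0 by (simp add: Lp_maps_def)
  then have "finite_measure Q"
    by (intro finite_measureI) (simp add: Q_def emeasure_density cong: nn_integral_cong)
  then have "I n < \<infinity>" for n
    using finite_measure.emeasure_finite[of Q "E n"] neq_top_trans[OF _ IQ[of n]] by (simp add: less_top)
  then have norm_iff: "(\<lambda>n. Lp_norm M p (h n)) \<longlonglongrightarrow> 0 \<longleftrightarrow> I \<longlonglongrightarrow> 0"
    unfolding I_def using \<open>1 \<le> p\<close> by (intro Lp_norm_tendsto_0_iff) auto
  have "I \<longlonglongrightarrow> 0 \<longleftrightarrow> (\<lambda>n. emeasure M (E n)) \<longlonglongrightarrow> 0"
  proof
    assume "I \<longlonglongrightarrow> 0"
    have "absolutely_continuous R M"
    proof -
      have "N \<in> null_sets M" if "N \<in> null_sets R" for N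
      proof -
        have N: "N \<in> sets M" "AE \<omega> in M. \<omega> \<in> N \<longrightarrow> ennreal (?r \<omega> powr p) = 0"
          using that by (auto simp: R_def null_sets_density_iff)
        have "AE \<omega> in M. \<omega> \<notin> N"
          using N(2) assms(11) by eventually_elim auto
        then show ?thesis using N(1) by (simp add: AE_iff_null_sets)
      qed
      then show ?thesis by (auto simp: absolutely_continuous_def)
    qed
    moreover have "(\<lambda>n. emeasure R (E n)) \<longlonglongrightarrow> 0"
      by (rule tendsto_sandwich[OF _ _ tendsto_const \<open>I \<longlonglongrightarrow> 0\<close>]) (auto simp: RI)
    ultimately show "(\<lambda>n. emeasure M (E n)) \<longlonglongrightarrow> 0"
      by (intro emeasure_tendsto_0_absolutely_continuous[of M R]) (auto simp: R_def)
  next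
    assume "(\<lambda>n. emeasure M (E n)) \<longlonglongrightarrow> 0"
    then have "(\<lambda>n. emeasure Q (E n)) \<longlonglongrightarrow> 0"
      using \<open>finite_measure Q\<close>
      by (intro emeasure_tendsto_0_absolutely_continuous[of Q M])
        (auto simp: Q_def intro!: absolutely_continuousI_density)
    then show "I \<longlonglongrightarrow> 0"
      by (rule tendsto_sandwich[OF _ _ tendsto_const, rotated 2]) (auto simp: IQ)
  qed
  also have "\<dots> \<longleftrightarrow> (\<lambda>n. measure M (E n)) \<longlonglongrightarrow> 0"
    by (simp add: emeasure_eq_measure flip: ennreal_0)
  finally show ?thesis
    using norm_iff by (simp add: h_def E_def)
qed

end
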